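(* Let $\alpha>0$, $\beta,h,\mu\in\mathbb{R}$, $c=0$, and consider wavetrains (with wavenumber $k$ and constant $r\in(0,1]$) of $$\partial_t\boldsymbol m=\boldsymbol m\times\big[\alpha\partial_t\boldsymbol m-\partial_x^2\boldsymbol m+(\mu m_3-h)\boldsymbol{\hat e}_3+\beta\,\boldsymbol m\times\boldsymbol{\hat e}_3\big],\qquad \boldsymbol m(x,t)\in\mathbb{S}^2,\ x\in\mathbb{R}.$$ Let $k_*$ be determined by $$k_*^2=\mu\,\frac{r^2}{4-3r^2}.$$ All wavetrains whose wavenumber satisfies $|k|>k_*$ (in the sense $k^2>k_*^2$) are unstable. For $\mu>0$, wavetrains with wavenumber $|k|<k_*$ are spectrally stable, while those with $|k|>k_*$ are unstable. In case $h\neq\beta/\alpha$ a sideband instability occurs at $k=\pm k_*$. There is no secondary instability for $k^2<\mu$. Nontrivial spectrally stable wavetrains exist only for supercritical anisotropy, $|h-\beta/\alpha|<\mu$.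
   Context: Write $\boldsymbol m=(re^{i\varphi},m_3)$, $r^2+m_3^2=1$, identifying the $(m_1,m_2)$-plane with $\mathbb{C}$. Wavetrains are solutions with $\varphi=kx-\omega t$ and constant $r\neq0$, $m_3$. For $c=0$ they satisfy $\omega=-\beta/\alpha$ and $(\mu-k^2)m_3=h-\beta/\alpha$. In the formula for $k_*^2$, $r$ is the (constant) radius of the wavetrain under consideration. Spectrum: linearizing in the variables $(\varphi,m_3)$, with time rescaled by $1+\alpha^2$ and up to shifts of $\lambda$ by purely imaginary multiples of $\ell$ (change to a comoving frame), the $L^2(\mathbb{R})$-spectrum of a wavetrain is given by the solutions $\lambda$ of $\det(A(i\ell)-\lambda)=0$, $\ell\in\mathbb{R}$, where $$A(\nu)=\begin{pmatrix}\alpha\nu^2+2km_3\nu & -r^{-2}\nu(-\nu+2\alpha km_3)+k^2-\mu\\ r^2\nu(-\nu+2\alpha km_3)&\alpha\nu^2+2km_3\nu+\alpha r^2(k^2-\mu)\end{pmatrix}.$$ Spectrally stable means no spectrum with positive real part; unstable means there is spectrum with positive real part. A sideband instability occurs when the second derivative at $\ell=0$ of the curve of spectrum $\tilde\lambda_0(\ell)$ with $\tilde\lambda_0(0)=0$ changes sign, so that the spectrum near the origin extends into positive real parts. "No secondary instability for $k^2<\mu$" means that for wavetrains with $k^2<\mu$ a transition from stable to unstable occurs only through this sideband instability. Supercritical anisotropy means that $\pm\boldsymbol{\hat e}_3$ are both unstable, which for $c=0$ is $\mu>|h-\beta/\alpha|$. *)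

theory Defs
  imports "HOL-Analysis.Analysis"
begin

unbundle cross3_syntax

abbreviation e3 :: "real^3" where
  "e3 \<equiv> axis 3 1"

definition llg_solution ::
    "real \<Rightarrow> real \<Rightarrow> real \<Rightarrow> real \<Rightarrow> (real \<Rightarrow> real \<Rightarrow> real^3) \<Rightarrow> bool" where
  "llg_solution \<alpha> \<beta> h \<mu> m \<longleftrightarrow>
     (\<forall>x t. norm (m x t) = 1) \<and>
     (\<exists>m\<^sub>t m\<^sub>x m\<^sub>x\<^sub>x. \<forall>x t.
        ((\<lambda>\<tau>. m x \<tau>) has_vector_derivative m\<^sub>t x t) (at t) \<and>
        ((\<lambda>\<xi>. m \<xi> t) has_vector_derivative m\<^sub>x x t) (at x) \<and>
        ((\<lambda>\<xi>. m\<^sub>x \<xi> t) has_vector_derivative m\<^sub>x\<^sub>x x t) (at x) \<and>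
        m\<^sub>t x t = m x t \<times>
          (\<alpha> *\<^sub>R m\<^sub>t x t - m\<^sub>x\<^sub>x x t + (\<mu> * (m x t $ 3) - h) *\<^sub>R e3
             + \<beta> *\<^sub>R (m x t \<times> e3)))"

unbundle no cross3_syntax

definition wavetrain_profile :: "real \<Rightarrow> real \<Rightarrow> real \<Rightarrow> real \<Rightarrow> real \<Rightarrow> real \<Rightarrow> real^3" where
  "wavetrain_profile k \<omega> r m3 x t =
     vector [r * cos (k * x - \<omega> * t), r * sin (k * x - \<omega> * t), m3]"

text \<open>The frequency relation \<open>\<omega> = - \<beta> / \<alpha>\<close> and the dispersion relation
  \<open>(\<mu> - k\<^sup>2) * m3 = h - \<beta> / \<alpha>\<close> are consequences of the equation and not part of the definition;
  likewise \<open>r\<^sup>2 + m3\<^sup>2 = 1\<close>, which is \<open>norm (m x t) = 1\<close>.\<close>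

definition wavetrain ::
    "real \<Rightarrow> real \<Rightarrow> real \<Rightarrow> real \<Rightarrow> real \<Rightarrow> real \<Rightarrow> real \<Rightarrow> real \<Rightarrow> bool" where
  "wavetrain \<alpha> \<beta> h \<mu> k \<omega> r m3 \<longleftrightarrow>
     0 < r \<and> r \<le> 1 \<and> llg_solution \<alpha> \<beta> h \<mu> (wavetrain_profile k \<omega> r m3)"

text \<open>Fourier symbol of the linearization in the variables \<open>(\<phi>, m3)\<close>, in the comoving frame and
  with time rescaled by \<open>1 + \<alpha>\<^sup>2\<close>. It depends on neither \<open>\<beta>\<close>, \<open>h\<close> nor \<open>\<omega>\<close>.\<close>

definition lin_symbol ::
    "real \<Rightarrow> real \<Rightarrow> real \<Rightarrow> real \<Rightarrow> real \<Rightarrow> complex \<Rightarrow> complex^2^2" where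
  "lin_symbol \<alpha> \<mu> k r m3 \<nu> =
     vector
      [vector [\<alpha> * \<nu>\<^sup>2 + 2 * k * m3 * \<nu>,
               - (1 / r\<^sup>2) * \<nu> * (- \<nu> + 2 * \<alpha> * k * m3) + k\<^sup>2 - \<mu>],
       vector [r\<^sup>2 * \<nu> * (- \<nu> + 2 * \<alpha> * k * m3),
               \<alpha> * \<nu>\<^sup>2 + 2 * k * m3 * \<nu> + \<alpha> * r\<^sup>2 * (k\<^sup>2 - \<mu>)]]"

definition spectrum_at ::
    "real \<Rightarrow> real \<Rightarrow> real \<Rightarrow> real \<Rightarrow> real \<Rightarrow> real \<Rightarrow> complex set" where
  "spectrum_at \<alpha> \<mu> k r m3 l =
     {z. det (lin_symbol \<alpha> \<mu> k r m3 (\<i> * complex_of_real l) - mat z) = 0}"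

text \<open>The \<open>L\<^sup>2(\<real>)\<close>-spectrum, up to imaginary shifts by multiples of \<open>l\<close>, which do not affect
  real parts.\<close>

definition wavetrain_spectrum ::
    "real \<Rightarrow> real \<Rightarrow> real \<Rightarrow> real \<Rightarrow> real \<Rightarrow> complex set" where
  "wavetrain_spectrum \<alpha> \<mu> k r m3 = (\<Union>l. spectrum_at \<alpha> \<mu> k r m3 l)"

definition spectrally_stable :: "real \<Rightarrow> real \<Rightarrow> real \<Rightarrow> real \<Rightarrow> real \<Rightarrow> bool" where
  "spectrally_stable \<alpha> \<mu> k r m3 \<longleftrightarrow> \<not> (\<exists>z \<in> wavetrain_spectrum \<alpha> \<mu> k r m3. 0 < Re z)"

definition spectrally_unstable :: "real \<Rightarrow> real \<Rightarrow> real \<Rightarrow> real \<Rightarrow> real \<Rightarrow> bool" where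
  "spectrally_unstable \<alpha> \<mu> k r m3 \<longleftrightarrow> (\<exists>z \<in> wavetrain_spectrum \<alpha> \<mu> k r m3. 0 < Re z)"

text \<open>\<open>f\<close> parametrizes the spectrum near the origin, with \<open>f 0 = 0\<close> and second derivative \<open>d\<close>
  at \<open>0\<close>. Taking \<open>d\<close> real is part of the claim: it gives a meaning to the sign of the second
  derivative of the complex-valued \<open>f\<close>.\<close>

definition critical_curve ::
    "real \<Rightarrow> real \<Rightarrow> real \<Rightarrow> real \<Rightarrow> real \<Rightarrow> (real \<Rightarrow> complex) \<Rightarrow> real \<Rightarrow> bool" where
  "critical_curve \<alpha> \<mu> k r m3 f d \<longleftrightarrow>
     f 0 = 0 \<and>
     (\<forall>\<^sub>F l in nhds 0. f l \<in> spectrum_at \<alpha> \<mu> k r m3 l) \<and>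
     (\<exists>f'. (\<forall>\<^sub>F l in nhds 0. (f has_vector_derivative f' l) (at l)) \<and>
           (f' has_vector_derivative complex_of_real d) (at 0))"

definition changes_sign_at :: "(real \<Rightarrow> real) \<Rightarrow> real \<Rightarrow> bool" where
  "changes_sign_at c s \<longleftrightarrow>
     ((\<forall>\<^sub>F x in at_left s. c x < 0) \<and> (\<forall>\<^sub>F x in at_right s. 0 < c x)) \<or>
     ((\<forall>\<^sub>F x in at_left s. 0 < c x) \<and> (\<forall>\<^sub>F x in at_right s. c x < 0))"

text \<open>The wavetrain \<open>(k0, r0, m0)\<close> is embedded into a continuous branch of wavetrains, with the
  coefficients \<open>\<alpha>, \<beta>, h, \<mu>\<close> fixed and the wavenumber as parameter. Along the branch the
  second derivative of the critical curve changes sign at \<open>k0\<close>, and where it is positive there is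
  spectrum with positive real part arbitrarily close to the origin.\<close>

definition sideband_instability ::
    "real \<Rightarrow> real \<Rightarrow> real \<Rightarrow> real \<Rightarrow> real \<Rightarrow> real \<Rightarrow> real \<Rightarrow> bool" where
  "sideband_instability \<alpha> \<beta> h \<mu> k0 r0 m0 \<longleftrightarrow>
     (\<exists>\<omega> r m3 f d.
        r k0 = r0 \<and> m3 k0 = m0 \<and> isCont r k0 \<and> isCont m3 k0 \<and>
        (\<forall>\<^sub>F k in nhds k0.
           wavetrain \<alpha> \<beta> h \<mu> k (\<omega> k) (r k) (m3 k) \<and>
           critical_curve \<alpha> \<mu> k (r k) (m3 k) (f k) (d k)) \<and>
        changes_sign_at d k0 \<and>
        (\<forall>\<^sub>F k in nhds k0. 0 < d k \<longrightarrow>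
           (\<forall>\<epsilon>>0. \<exists>z \<in> wavetrain_spectrum \<alpha> \<mu> k (r k) (m3 k). norm z < \<epsilon> \<and> 0 < Re z)))"

text \<open>The wavetrain \<open>(k0, r0, m0)\<close> is a limit both of stable and of unstable wavetrains for the
  same \<open>\<alpha>, \<beta>, h, \<mu>\<close>.\<close>

definition stability_transition ::
    "real \<Rightarrow> real \<Rightarrow> real \<Rightarrow> real \<Rightarrow> real \<Rightarrow> real \<Rightarrow> real \<Rightarrow> bool" where
  "stability_transition \<alpha> \<beta> h \<mu> k0 r0 m0 \<longleftrightarrow>
     (\<forall>\<epsilon>>0.
        (\<exists>k \<omega> r m3. wavetrain \<alpha> \<beta> h \<mu> k \<omega> r m3 \<and> dist (k, r, m3) (k0, r0, m0) < \<epsilon> \<and>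
                    spectrally_stable \<alpha> \<mu> k r m3) \<and>
        (\<exists>k \<omega> r m3. wavetrain \<alpha> \<beta> h \<mu> k \<omega> r m3 \<and> dist (k, r, m3) (k0, r0, m0) < \<epsilon> \<and>
                    spectrally_unstable \<alpha> \<mu> k r m3))"

text \<open>The square of the critical wavenumber; for \<open>\<mu> < 0\<close> it is negative.\<close>

definition kstar_sq :: "real \<Rightarrow> real \<Rightarrow> real" where
  "kstar_sq \<mu> r = \<mu> * (r\<^sup>2 / (4 - 3 * r\<^sup>2))"

end

theory Submission
  imports Defs
begin

text \<open>
  Put \<open>M = r\<^sup>2 * (\<mu> - k\<^sup>2)\<close> and \<open>s = 2 * k * m3\<close>. Everything is governed by the sign of
  \<open>M - s\<^sup>2\<close>, which on wavetrains, where \<open>r\<^sup>2 + m3\<^sup>2 = 1\<close>, equals \<open>\<mu> * r\<^sup>2 - k\<^sup>2 * (4 - 3 * r\<^sup>2)\<close> and so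
  vanishes exactly at the critical wavenumber (\<open>kstar_sq_iff_margin\<close>).

  Writing a point of the spectrum as \<open>u + \<i> * t\<close> with \<open>t = s * l\<close>, a translation that keeps the real
  part, turns the determinant condition into
  \<open>u\<^sup>2 + p * u + q + \<i> * t * p = 0\<close>, where \<open>p = \<alpha> * (2 * l\<^sup>2 + M)\<close> and
  \<open>q = t\<^sup>2 + (1 + \<alpha>\<^sup>2) * l\<^sup>2 * (l\<^sup>2 + M - s\<^sup>2)\<close>. The imaginary part of the constant term carries the same
  factor \<open>p\<close> as the linear term. The Routh--Hurwitz criterion for such a quadratic with \<open>p > 0\<close>
  therefore compares just \<open>q\<close> with \<open>t\<^sup>2\<close>: there is a root in the open right half plane if and only if
  \<open>q < t\<^sup>2\<close>. That happens for some \<open>l\<close> if and only if \<open>M < s\<^sup>2\<close>; for \<open>M < 0\<close> the positive eigenvalue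
  \<open>- \<alpha> * M\<close> at \<open>l = 0\<close> gives instability at once. This is \<open>spectrally_unstable_iff_margin\<close>, and it
  contains all statements about stable and unstable wavenumbers.

  If \<open>M > 0\<close>, the quadratic formula gives the critical curve explicitly. Its second
  derivative at the origin is \<open>2 * (1 + \<alpha>\<^sup>2) * (s\<^sup>2 - M) / (\<alpha> * M)\<close>
  (\<open>critical_curve_critical_root\<close>), positive precisely for unstable wavetrains. So whenever there is
  unstable spectrum at all, there is some arbitrarily close to the origin. Along a branch of wavetrains with \<open>h\<close> and \<open>\<beta>\<close>
  fixed, \<open>h \<noteq> \<beta> / \<alpha>\<close> and \<open>k\<^sup>2 < \<mu>\<close>, the modulus of \<open>m3 = (h - \<beta> / \<alpha>) / (\<mu> - k\<^sup>2)\<close> grows with \<open>k\<^sup>2\<close>, so that \<open>M - s\<^sup>2\<close> is strictly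
  decreasing in \<open>k\<^sup>2\<close> (\<open>branch_margin_strict_antimono\<close>) and the second derivative changes sign
  exactly at the critical wavenumber.

  Finally, stability forces \<open>M \<ge> s\<^sup>2 \<ge> 0\<close>, hence \<open>k\<^sup>2 \<le> \<mu>\<close>, and then the dispersion relation
  with \<open>\<bar>m3\<bar> < 1\<close> bounds \<open>\<bar>h - \<beta> / \<alpha>\<bar>\<close> by \<open>\<mu>\<close>.
\<close>

section \<open>Existence of wavetrains\<close>

lemma vector3_has_vector_derivative:
  fixes f g q :: "real \<Rightarrow> real"
  assumes "(f has_real_derivative f') (at t)"
    and "(g has_real_derivative g') (at t)"
    and "(q has_real_derivative q') (at t)"
  shows "((\<lambda>t. vector [f t, g t, q t] :: real^3) has_vector_derivative vector [f', g', q']) (at t)"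
proof -
  have eq: "(vector [a, b, c] :: real^3) = a *\<^sub>R axis 1 1 + b *\<^sub>R axis 2 1 + c *\<^sub>R axis 3 1"
    for a b c :: real
    by (simp add: vec_eq_iff forall_3 axis_def)
  have "((\<lambda>t. f t *\<^sub>R axis 1 1 + g t *\<^sub>R axis 2 1 + q t *\<^sub>R axis 3 1 :: real^3)
      has_vector_derivative f' *\<^sub>R axis 1 1 + g' *\<^sub>R axis 2 1 + q' *\<^sub>R axis 3 1) (at t)"
    by (auto intro!: derivative_eq_intros assms)
  then show ?thesis
    by (simp only: eq)
qed

lemma wavetrain_profile_derivatives:
  shows "((\<lambda>\<tau>. wavetrain_profile k \<omega> r m3 x \<tau>) has_vector_derivative
      vector [r * \<omega> * sin (k * x - \<omega> * t), - r * \<omega> * cos (k * x - \<omega> * t), 0]) (at t)"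
    and "((\<lambda>\<xi>. wavetrain_profile k \<omega> r m3 \<xi> t) has_vector_derivative
      vector [- r * k * sin (k * x - \<omega> * t), r * k * cos (k * x - \<omega> * t), 0]) (at x)"
    and "((\<lambda>\<xi>. vector [- r * k * sin (k * \<xi> - \<omega> * t), r * k * cos (k * \<xi> - \<omega> * t), 0] :: real^3)
      has_vector_derivative
      vector [- r * k\<^sup>2 * cos (k * x - \<omega> * t), - r * k\<^sup>2 * sin (k * x - \<omega> * t), 0]) (at x)"
  unfolding wavetrain_profile_def
  by (rule vector3_has_vector_derivative;
      auto intro!: derivative_eq_intros simp: power2_eq_square)+

lemma norm_wavetrain_profile: "norm (wavetrain_profile k \<omega> r m3 x t) = sqrt (r\<^sup>2 + m3\<^sup>2)"
proof -
  have "(r * cos \<theta>)\<^sup>2 + (r * sin \<theta>)\<^sup>2 = r\<^sup>2" for \<theta>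
    by (simp add: power_mult_distrib flip: distrib_left)
  then show ?thesis
    by (simp add: norm_eq_sqrt_inner inner_vec_def sum_3 wavetrain_profile_def flip: power2_eq_square)
qed

text \<open>By the rotation symmetry about the third axis the equation has the same content at every
  phase, so the necessary conditions can be read off at \<open>x = t = 0\<close>: the third component of the
  equation gives \<open>\<omega>\<close>, the second one the dispersion relation.\<close>

lemma wavetrain_iff:
  assumes "\<alpha> > 0"
  shows "wavetrain \<alpha> \<beta> h \<mu> k \<omega> r m3 \<longleftrightarrow>
     0 < r \<and> r\<^sup>2 + m3\<^sup>2 = 1 \<and> \<omega> = - \<beta> / \<alpha> \<and> (\<mu> - k\<^sup>2) * m3 = h - \<beta> / \<alpha>"
    (is "?L \<longleftrightarrow> ?R")
proof
  assume L: ?L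
  let ?m = "wavetrain_profile k \<omega> r m3"
  from L have r: "0 < r" "r \<le> 1" and sol: "llg_solution \<alpha> \<beta> h \<mu> ?m"
    by (auto simp: wavetrain_def)
  from sol have "norm (?m 0 0) = 1"
    by (simp add: llg_solution_def)
  then have nrm: "r\<^sup>2 + m3\<^sup>2 = 1"
    by (simp add: norm_wavetrain_profile)
  from sol obtain mt mx mxx where
    D: "\<And>x t. ((\<lambda>\<tau>. ?m x \<tau>) has_vector_derivative mt x t) (at t)"
       "\<And>x t. ((\<lambda>\<xi>. ?m \<xi> t) has_vector_derivative mx x t) (at x)"
       "\<And>x t. ((\<lambda>\<xi>. mx \<xi> t) has_vector_derivative mxx x t) (at x)"
    and eq: "\<And>x t. mt x t = cross3 (?m x t)
          (\<alpha> *\<^sub>R mt x t - mxx x t + (\<mu> * (?m x t $ 3) - h) *\<^sub>R e3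
             + \<beta> *\<^sub>R (cross3 (?m x t) e3))"
    unfolding llg_solution_def by blast
  have mt: "mt 0 0 = vector [0, - r * \<omega>, 0]"
    using vector_derivative_unique_at[OF D(1) wavetrain_profile_derivatives(1), of 0 0] by simp
  have "mx = (\<lambda>x t. vector [- r * k * sin (k * x - \<omega> * t), r * k * cos (k * x - \<omega> * t), 0])"
    using vector_derivative_unique_at[OF D(2) wavetrain_profile_derivatives(2)] by blast
  then have mxx: "mxx 0 0 = vector [- r * k\<^sup>2, 0, 0]"
    using vector_derivative_unique_at[OF D(3)[of 0 0]] wavetrain_profile_derivatives(3)[of r k \<omega> 0 0]
    by fastforce
  have e: "vector [0, - r * \<omega>, 0] = cross3 (?m 0 0)
          (\<alpha> *\<^sub>R vector [0, - r * \<omega>, 0] - vector [- r * k\<^sup>2, 0, 0]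
             + (\<mu> * (?m 0 0 $ 3) - h) *\<^sub>R e3 + \<beta> *\<^sub>R (cross3 (?m 0 0) e3))"
    using eq[of 0 0] by (simp only: mt mxx)
  have "(r * r) * (\<alpha> * \<omega> + \<beta>) = 0 \<and> r * (\<omega> - (\<mu> * m3 - h - m3 * k\<^sup>2)) = 0"
    using e by (auto simp: vec_eq_iff forall_3 cross3_def wavetrain_profile_def axis_def algebra_simps)
  then have "\<alpha> * \<omega> + \<beta> = 0" "\<omega> = \<mu> * m3 - h - m3 * k\<^sup>2"
    using r by (auto simp only: mult_eq_0_iff)
  then have "\<alpha> * \<omega> = - \<beta>" "(\<mu> - k\<^sup>2) * m3 = h + \<omega>"
    by (simp_all only: eq_neg_iff_add_eq_0) (simp add: algebra_simps)
  moreover from this(1) have "\<omega> = - \<beta> / \<alpha>"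
    using assms by (metis nonzero_mult_div_cancel_left less_irrefl)
  ultimately show ?R using r nrm by simp
next
  assume R: ?R
  then have "r\<^sup>2 \<le> 1"
    by (metis le_add_same_cancel1 zero_le_power2)
  then have "r \<le> 1"
    using R by (simp add: power_le_one_iff)
  moreover have "llg_solution \<alpha> \<beta> h \<mu> (wavetrain_profile k \<omega> r m3)"
  proof -
    have w: "\<alpha> * \<omega> = - \<beta>" "h = (\<mu> - k\<^sup>2) * m3 - \<omega>"
      using R assms by simp_all
    have "norm (wavetrain_profile k \<omega> r m3 x t) = 1" for x t
      using R by (simp add: norm_wavetrain_profile)
    moreover have "vector [r * \<omega> * sin \<theta>, - r * \<omega> * cos \<theta>, 0] = cross3 (vector [r * cos \<theta>, r * sin \<theta>, m3])
        (\<alpha> *\<^sub>R vector [r * \<omega> * sin \<theta>, - r * \<omega> * cos \<theta>, 0]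
         - vector [- r * k\<^sup>2 * cos \<theta>, - r * k\<^sup>2 * sin \<theta>, 0]
         + (\<mu> * ((vector [r * cos \<theta>, r * sin \<theta>, m3] :: real^3) $ 3) - h) *\<^sub>R e3
         + \<beta> *\<^sub>R (cross3 (vector [r * cos \<theta>, r * sin \<theta>, m3]) e3))" for \<theta>
    proof -
      have "\<beta> = - (\<alpha> * \<omega>)" using w by simp
      then show ?thesis
        by (simp add: vec_eq_iff forall_3 cross3_def axis_def w(2) algebra_simps)
    qed
    ultimately show ?thesis
      unfolding llg_solution_def
      by (intro conjI allI exI[of _ "\<lambda>x t. vector [r * \<omega> * sin (k * x - \<omega> * t), - r * \<omega> * cos (k * x - \<omega> * t), 0]"]
        exI[of _ "\<lambda>x t. vector [- r * k * sin (k * x - \<omega> * t), r * k * cos (k * x - \<omega> * t), 0]"]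
        exI[of _ "\<lambda>x t. vector [- r * k\<^sup>2 * cos (k * x - \<omega> * t), - r * k\<^sup>2 * sin (k * x - \<omega> * t), 0]"]
         wavetrain_profile_derivatives) (simp_all add: wavetrain_profile_def)
  qed
  ultimately show ?L
    using R by (simp add: wavetrain_def)
qed

section \<open>The spectrum as the roots of quadratics\<close>

text \<open>The difference \<open>M - s\<^sup>2\<close> of the introduction.\<close>

definition stability_margin :: "real \<Rightarrow> real \<Rightarrow> real \<Rightarrow> real \<Rightarrow> real" where
  "stability_margin \<mu> k r m3 = r\<^sup>2 * (\<mu> - k\<^sup>2) - (2 * k * m3)\<^sup>2"

text \<open>Both diagonal entries of the symbol contain \<open>\<alpha> * \<nu>\<^sup>2 + s * \<nu>\<close>. Subtracting it
  from \<open>z\<close> leaves a quadratic without \<open>\<nu>\<close> in its linear coefficient, which can be solved by a single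
  square root.\<close>

lemma spectrum_at_iff:
  fixes z :: complex
  assumes "r \<noteq> 0"
  shows "z \<in> spectrum_at \<alpha> \<mu> k r m3 l \<longleftrightarrow>
    (let M = complex_of_real (r\<^sup>2 * (\<mu> - k\<^sup>2)); \<nu> = \<i> * complex_of_real l; s = complex_of_real (2 * k * m3);
         w = z - (\<alpha> * \<nu>\<^sup>2 + s * \<nu>); P = \<alpha> * s * \<nu> - \<nu>\<^sup>2
     in w\<^sup>2 + \<alpha> * M * w + P * (P + M) = 0)"
proof -
  define \<nu> where "\<nu> = \<i> * complex_of_real l"
  define M where "M = complex_of_real (r\<^sup>2 * (\<mu> - k\<^sup>2))"
  define s where "s = complex_of_real (2 * k * m3)"
  define w where "w = z - (\<alpha> * \<nu>\<^sup>2 + s * \<nu>)"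
  define P where "P = \<alpha> * s * \<nu> - \<nu>\<^sup>2"
  define R where "R = complex_of_real (r\<^sup>2)"
  have R: "R \<noteq> 0" using assms by (simp add: R_def)
  let ?A = "lin_symbol \<alpha> \<mu> k r m3 \<nu> - mat z"
  have e11: "?A $ 1 $ 1 = - w"
    by (simp add: lin_symbol_def mat_def w_def s_def)
  have e12: "?A $ 1 $ 2 = - (P + M) / R"
    using R by (simp add: lin_symbol_def mat_def M_def P_def s_def R_def field_simps power2_eq_square)
  have e21: "?A $ 2 $ 1 = R * P"
    by (simp add: lin_symbol_def mat_def P_def s_def R_def algebra_simps power2_eq_square)
  have e22: "?A $ 2 $ 2 = - w - \<alpha> * M"
    by (simp add: lin_symbol_def mat_def w_def s_def M_def algebra_simps)
  have "det ?A = (- w) * (- w - \<alpha> * M) + (P + M) * P"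
    unfolding det_2 e11 e12 e21 e22 using R by simp (simp add: algebra_simps)
  also have "\<dots> = w\<^sup>2 + \<alpha> * M * w + P * (P + M)"
    by (simp add: algebra_simps power2_eq_square)
  finally show ?thesis
    by (simp add: spectrum_at_def Let_def w_def P_def M_def s_def \<nu>_def)
qed

text \<open>The imaginary part of the equation reads \<open>(2 * Re u + p) * Im u = - t * p\<close>. To the right of
  the imaginary axis it forces \<open>\<bar>Im u\<bar> \<le> \<bar>t\<bar>\<close>, and then the real part of the equation is
  positive.\<close>

lemma quadratic_roots_in_left_half_plane:
  fixes p q t :: real and u :: complex
  assumes "u\<^sup>2 + p * u + q + \<i> * t * p = 0" "0 \<le> p" "t\<^sup>2 \<le> q"
  shows "Re u \<le> 0"
proof (rule ccontr)
  assume "\<not> Re u \<le> 0"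
  then have x: "Re u > 0" by simp
  have re: "(Re u)\<^sup>2 - (Im u)\<^sup>2 + p * Re u + q = 0"
    using arg_cong[OF assms(1), of Re] by (simp add: power2_eq_square)
  have "(2 * Re u + p) * Im u = - t * p"
    using arg_cong[OF assms(1), of Im] by (simp add: power2_eq_square algebra_simps)
  then have "(2 * Re u + p) * \<bar>Im u\<bar> = \<bar>t\<bar> * p"
    using x assms(2) by (metis abs_mult abs_of_nonneg abs_minus add_nonneg_nonneg less_imp_le mult_nonneg_nonneg zero_le_numeral)
  also have "\<dots> \<le> (2 * Re u + p) * \<bar>t\<bar>"
    using x by (simp add: algebra_simps)
  finally have "\<bar>Im u\<bar> \<le> \<bar>t\<bar>"
    using x assms(2) by simp
  then have "(Im u)\<^sup>2 \<le> q"
    using assms(3) by (meson abs_le_square_iff order_trans)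
  moreover have "(Re u)\<^sup>2 > 0" "p * Re u \<ge> 0"
    using x assms(2) by simp_all
  ultimately show False using re by linarith
qed

text \<open>Eliminating the imaginary part of \<open>u\<close> as before leaves one real equation for \<open>Re u\<close>, negative at
  \<open>0\<close> when \<open>q < t\<^sup>2\<close> and nonnegative far to the right, so that the intermediate value theorem applies.\<close>

lemma quadratic_root_in_right_half_plane:
  fixes p q t :: real
  assumes "0 < p" "q < t\<^sup>2"
  obtains u :: complex where "u\<^sup>2 + p * u + q + \<i> * t * p = 0" "Re u > 0"
proof -
  define g where "g x = x\<^sup>2 + p * x + q - (t * p / (2 * x + p))\<^sup>2" for x
  have "q \<ge> -\<bar>q\<bar>" by simp
  \<comment> \<open>Since \<open>X\<^sup>2 \<ge> X\<close>, the square outweighs \<open>q\<close> and the subtracted term, which is at most \<open>t\<^sup>2\<close>.\<close>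
  define X where "X = 1 + \<bar>q\<bar> + t\<^sup>2"
  have X: "X \<ge> 1" by (simp add: X_def)
  have "(t * p / (2 * X + p))\<^sup>2 \<le> t\<^sup>2"
  proof -
    have "\<bar>t * p / (2 * X + p)\<bar> \<le> \<bar>t\<bar>"
      using assms X by (simp add: abs_mult divide_le_eq mult_left_mono)
    then show ?thesis by (simp only: abs_le_square_iff)
  qed
  moreover have "X\<^sup>2 \<ge> X" using X by (simp add: power2_eq_square)
  moreover have "p * X \<ge> 0" using X assms by simp
  ultimately have "g X \<ge> 0"
    using \<open>q \<ge> -\<bar>q\<bar>\<close> unfolding g_def X_def by linarith
  moreover have "g 0 < 0" using assms by (simp add: g_def)
  moreover have "continuous_on {0..X} g"
    unfolding g_def using assms by (intro continuous_intros) auto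
  ultimately obtain x where x: "0 \<le> x" "g x = 0"
    using IVT'[of g 0 0 X] X by auto
  with \<open>g 0 < 0\<close> have "x > 0" by (cases "x = 0") auto
  define y where "y = - (t * p / (2 * x + p))"
  have re: "x\<^sup>2 - y\<^sup>2 + p * x + q = 0"
    using x by (simp add: g_def y_def)
  have im: "2 * x * y + p * y + t * p = 0"
  proof -
    have "2 * x + p \<noteq> 0" using \<open>x > 0\<close> assms by simp
    then have "(2 * x + p) * y = - (t * p)" by (simp add: y_def)
    then show ?thesis by (simp add: algebra_simps)
  qed
  have "(Complex x y)\<^sup>2 + p * Complex x y + q + \<i> * t * p = 0"
    using re im by (simp add: complex_eq_iff power2_eq_square algebra_simps)
  then show ?thesis
    using that[of "Complex x y"] \<open>x > 0\<close> by simp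
qed

text \<open>The translation by \<open>\<i> * t\<close> makes all coefficients real except the last one, and
  puts the criterion for roots in the right half plane into the form of the two preceding lemmas, since \<open>q - t\<^sup>2\<close> appears as a
  multiple of \<open>l\<^sup>2 + stability_margin \<mu> k r m3\<close>.\<close>

lemma spectrum_at_iff_quadratic:
  fixes \<alpha> \<mu> k r m3 l :: real and u :: complex
  assumes "r \<noteq> 0"
  defines "p \<equiv> \<alpha> * (2 * l\<^sup>2 + r\<^sup>2 * (\<mu> - k\<^sup>2))" and "t \<equiv> 2 * k * m3 * l"
  shows "u + \<i> * t \<in> spectrum_at \<alpha> \<mu> k r m3 l \<longleftrightarrow>
    u\<^sup>2 + p * u + (t\<^sup>2 + (1 + \<alpha>\<^sup>2) * l\<^sup>2 * (l\<^sup>2 + stability_margin \<mu> k r m3) :: real) + \<i> * t * p = 0"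
proof -
  define M where "M = r\<^sup>2 * (\<mu> - k\<^sup>2)"
  define s where "s = 2 * k * m3"
  have mg: "stability_margin \<mu> k r m3 = M - s\<^sup>2"
    by (simp add: stability_margin_def M_def s_def)
  show ?thesis
    unfolding spectrum_at_iff[OF assms(1)] Let_def p_def t_def mg
    unfolding M_def[symmetric] s_def[symmetric]
    by (simp add: algebra_simps power2_eq_square power_mult_distrib)
qed

section \<open>The stability criterion\<close>

text \<open>If the margin is nonnegative, every \<open>l\<close> satisfies the hypotheses of
  \<open>quadratic_roots_in_left_half_plane\<close>. If it is negative, wavenumbers \<open>l \<noteq> 0\<close> with
  \<open>l\<^sup>2 + stability_margin \<mu> k r m3 < 0\<close> are unstable as soon as \<open>p > 0\<close>, which holds when
  \<open>\<mu> \<ge> k\<^sup>2\<close>; otherwise there is a positive eigenvalue at \<open>l = 0\<close>.\<close>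

lemma spectrally_unstable_iff_margin:
  assumes "\<alpha> > 0" "r \<noteq> 0"
  shows "spectrally_unstable \<alpha> \<mu> k r m3 \<longleftrightarrow> stability_margin \<mu> k r m3 < 0"
proof
  assume "spectrally_unstable \<alpha> \<mu> k r m3"
  then obtain z l where z: "z \<in> spectrum_at \<alpha> \<mu> k r m3 l" "0 < Re z"
    by (auto simp: spectrally_unstable_def wavetrain_spectrum_def)
  define t where "t = 2 * k * m3 * l"
  define u where "u = z - \<i> * t"
  have u: "u + \<i> * t \<in> spectrum_at \<alpha> \<mu> k r m3 l" "0 < Re u"
    using z by (simp_all add: u_def)
  show "stability_margin \<mu> k r m3 < 0"
  proof (rule ccontr)
    assume neg: "\<not> ?thesis"
    have "r\<^sup>2 * (\<mu> - k\<^sup>2) \<ge> 0"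
      using neg zero_le_power2[of "2 * k * m3"] unfolding stability_margin_def by linarith
    then have "Re u \<le> 0"
      using neg assms
      by (intro quadratic_roots_in_left_half_plane
            [OF u(1)[unfolded t_def spectrum_at_iff_quadratic[OF assms(2)]]]) auto
    with u(2) show False by simp
  qed
next
  assume neg: "stability_margin \<mu> k r m3 < 0"
  show "spectrally_unstable \<alpha> \<mu> k r m3"
  proof (cases "r\<^sup>2 * (\<mu> - k\<^sup>2) < 0")
    case True
    define z where "z = - (\<alpha> * (r\<^sup>2 * (\<mu> - k\<^sup>2)))"
    have "complex_of_real z \<in> spectrum_at \<alpha> \<mu> k r m3 0"
      unfolding spectrum_at_iff[OF assms(2)] Let_def
      by (simp add: z_def power2_eq_square)
    moreover have "z > 0"
      using True assms(1) by (simp add: z_def mult_pos_neg)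
    ultimately show ?thesis
      unfolding spectrally_unstable_def wavetrain_spectrum_def by force
  next
    case False
    \<comment> \<open>Any \<open>l\<close> with \<open>0 < l\<^sup>2 < - stability_margin \<mu> k r m3\<close> would serve.\<close>
    define l where "l = sqrt (- stability_margin \<mu> k r m3 / 2)"
    have l2: "l\<^sup>2 = - stability_margin \<mu> k r m3 / 2" "l\<^sup>2 > 0"
      using neg by (simp_all add: l_def)
    define t where "t = 2 * k * m3 * l"
    define p where "p = \<alpha> * (2 * l\<^sup>2 + r\<^sup>2 * (\<mu> - k\<^sup>2))"
    define q where "q = t\<^sup>2 + (1 + \<alpha>\<^sup>2) * l\<^sup>2 * (l\<^sup>2 + stability_margin \<mu> k r m3)"
    have "0 < p"
      unfolding p_def using assms(1) l2(2) False by (intro mult_pos_pos add_pos_nonneg) auto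
    moreover have "(1 + \<alpha>\<^sup>2) * l\<^sup>2 * (l\<^sup>2 + stability_margin \<mu> k r m3) < 0"
      using l2 neg by (intro mult_pos_neg mult_pos_pos) (auto simp: add_pos_nonneg)
    then have "q < t\<^sup>2"
      by (simp add: q_def)
    ultimately obtain u :: complex where u: "u\<^sup>2 + p * u + q + \<i> * t * p = 0" "Re u > 0"
      by (rule quadratic_root_in_right_half_plane)
    from u(1) have "u + \<i> * t \<in> spectrum_at \<alpha> \<mu> k r m3 l"
      unfolding p_def q_def t_def spectrum_at_iff_quadratic[OF assms(2)] .
    moreover have "Re (u + \<i> * t) > 0" using u(2) by simp
    ultimately show ?thesis
      unfolding spectrally_unstable_def wavetrain_spectrum_def by blast
  qed
qed

lemma kstar_sq_iff_margin:
  assumes "0 < r" "r\<^sup>2 + m3\<^sup>2 = 1"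
  shows "kstar_sq \<mu> r < k\<^sup>2 \<longleftrightarrow> stability_margin \<mu> k r m3 < 0"
    and "k\<^sup>2 = kstar_sq \<mu> r \<longleftrightarrow> stability_margin \<mu> k r m3 = 0"
proof -
  have m: "m3\<^sup>2 = 1 - r\<^sup>2" using assms by simp
  have "4 - 3 * r\<^sup>2 > 0" using m zero_le_power2[of m3] by linarith
  moreover have "stability_margin \<mu> k r m3 = \<mu> * r\<^sup>2 - k\<^sup>2 * (4 - 3 * r\<^sup>2)"
    unfolding stability_margin_def power_mult_distrib m by (simp add: algebra_simps)
  ultimately show "kstar_sq \<mu> r < k\<^sup>2 \<longleftrightarrow> stability_margin \<mu> k r m3 < 0"
    "k\<^sup>2 = kstar_sq \<mu> r \<longleftrightarrow> stability_margin \<mu> k r m3 = 0"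
    by (auto simp: kstar_sq_def divide_less_eq eq_divide_eq)
qed


section \<open>The critical curve\<close>

text \<open>The point of the spectrum obtained from the quadratic of \<open>spectrum_at_iff\<close>. The sign of the
  square root is the one for which it vanishes at \<open>l = 0\<close> when \<open>\<alpha> * M > 0\<close>,
  with the parameters \<open>M\<close> and \<open>s\<close> of the introduction. The argument \<open>z\<close>, standing
  for \<open>l\<close>, is complex so that the curve can be differentiated as a holomorphic function.\<close>

definition critical_root :: "real \<Rightarrow> real \<Rightarrow> real \<Rightarrow> complex \<Rightarrow> complex" where
  "critical_root \<alpha> M s z = - \<alpha> * z\<^sup>2 + \<i> * s * z +
     (csqrt ((\<alpha> * M)\<^sup>2 - 4 * (z\<^sup>2 + \<i> * \<alpha> * s * z) * (z\<^sup>2 + \<i> * \<alpha> * s * z + M)) - \<alpha> * M) / 2"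

lemma critical_root_in_spectrum:
  assumes "r \<noteq> 0"
  shows "critical_root \<alpha> (r\<^sup>2 * (\<mu> - k\<^sup>2)) (2 * k * m3) l \<in> spectrum_at \<alpha> \<mu> k r m3 l"
proof -
  define M where "M = complex_of_real (r\<^sup>2 * (\<mu> - k\<^sup>2))"
  define s where "s = complex_of_real (2 * k * m3)"
  define P where "P = (complex_of_real l)\<^sup>2 + \<i> * \<alpha> * s * l"
  define a where "a = - \<alpha> * (complex_of_real l)\<^sup>2 + \<i> * s * l"
  define C where "C = csqrt ((\<alpha> * M)\<^sup>2 - 4 * P * (P + M))"
  have C: "C\<^sup>2 = (\<alpha> * M)\<^sup>2 - 4 * P * (P + M)"
    by (simp add: C_def)
  have "((C - \<alpha> * M) / 2)\<^sup>2 + \<alpha> * M * ((C - \<alpha> * M) / 2) + P * (P + M)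
      = (C\<^sup>2 - (\<alpha> * M)\<^sup>2) / 4 + P * (P + M)"
    by (simp add: field_simps power2_eq_square)
  also have "\<dots> = 0"
    unfolding C by (simp add: field_simps)
  finally have root: "((C - \<alpha> * M) / 2)\<^sup>2 + \<alpha> * M * ((C - \<alpha> * M) / 2) + P * (P + M) = 0" .
  have f: "critical_root \<alpha> (r\<^sup>2 * (\<mu> - k\<^sup>2)) (2 * k * m3) l = a + (C - \<alpha> * M) / 2"
    unfolding critical_root_def C_def a_def P_def M_def s_def by simp
  have a: "\<alpha> * (\<i> * complex_of_real l)\<^sup>2 + s * (\<i> * complex_of_real l) = a"
    by (simp add: a_def power_mult_distrib)
  have P: "\<alpha> * s * (\<i> * complex_of_real l) - (\<i> * complex_of_real l)\<^sup>2 = P"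
    by (simp add: P_def power_mult_distrib)
  show ?thesis
    unfolding spectrum_at_iff[OF assms] Let_def f M_def[symmetric] s_def[symmetric] a P
    using root by simp
qed

lemma isCont_tendsto_nhds: "isCont f a \<Longrightarrow> (f \<longlongrightarrow> f a) (nhds a)"
  by (simp add: isCont_def tendsto_at_iff_tendsto_nhds)

text \<open>For \<open>M > 0\<close> the discriminant is positive at the origin, hence stays off the branch cut of
  the square root nearby. The first derivative at \<open>0\<close> vanishes, as the term \<open>\<i> * s\<close> cancels against
  the contribution of the square root.\<close>

lemma critical_root_second_order:
  fixes \<alpha> M s :: real
  assumes "\<alpha> > 0" "M > 0"
  shows "critical_root \<alpha> M s 0 = 0"
    and "\<exists>f'. (\<forall>\<^sub>F l in nhds 0. ((\<lambda>l. critical_root \<alpha> M s (complex_of_real l)) has_vector_derivative f' l) (at l)) \<and>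
      (f' has_vector_derivative complex_of_real (2 * (1 + \<alpha>\<^sup>2) * (s\<^sup>2 - M) / (\<alpha> * M))) (at 0)"
proof -
  have sq0: "csqrt ((complex_of_real \<alpha> * complex_of_real M)\<^sup>2) = \<alpha> * M"
    using assms csqrt_square[of "complex_of_real \<alpha> * complex_of_real M"] by simp
  show "critical_root \<alpha> M s 0 = 0"
    by (simp add: critical_root_def sq0)
  define P where "P z = z\<^sup>2 + \<i> * \<alpha> * s * z" for z :: complex
  define P' where "P' z = 2 * z + \<i> * \<alpha> * s" for z :: complex
  define D where "D z = (\<alpha> * M)\<^sup>2 - 4 * P z * (P z + M)" for z :: complex
  define D' where "D' z = - 4 * P' z * (2 * P z + M)" for z :: complex
  define F' where "F' z = - 2 * \<alpha> * z + \<i> * s + D' z / (4 * csqrt (D z))" for z :: complex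
  have dP: "(P has_field_derivative P' z) (at z)" for z
    unfolding P_def P'_def by (auto intro!: derivative_eq_intros)
  have dP': "(P' has_field_derivative 2) (at z)" for z
    unfolding P'_def by (auto intro!: derivative_eq_intros)
  have dD: "(D has_field_derivative D' z) (at z)" for z
    unfolding D_def D'_def by (auto intro!: derivative_eq_intros dP simp: algebra_simps)
  have dD': "(D' has_field_derivative - 8 * (2 * P z + M) - 8 * (P' z)\<^sup>2) (at z)" for z
    unfolding D'_def
    by (auto intro!: derivative_eq_intros dP dP' simp: algebra_simps power2_eq_square)
  have D0: "D 0 = complex_of_real ((\<alpha> * M)\<^sup>2)"
    by (simp add: D_def P_def)
  have D0nn: "D 0 \<notin> \<real>\<^sub>\<le>\<^sub>0"
    using assms by (simp only: D0 complex_nonpos_Reals_iff) simp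
  have "((\<lambda>l. D (complex_of_real l)) \<longlongrightarrow> D 0) (nhds 0)"
  proof -
    have "isCont (\<lambda>l. D (complex_of_real l)) 0"
      unfolding D_def P_def by (intro continuous_intros)
    from isCont_tendsto_nhds[OF this] show ?thesis by simp
  qed
  then have ev: "\<forall>\<^sub>F l in nhds 0. D (complex_of_real l) \<in> - \<real>\<^sub>\<le>\<^sub>0"
    by (rule topological_tendstoD) (use D0nn in \<open>simp_all only: Compl_iff not_False_eq_True open_Compl closed_nonpos_Reals_complex\<close>)
  have dF: "(critical_root \<alpha> M s has_field_derivative F' z) (at z)" if "D z \<notin> \<real>\<^sub>\<le>\<^sub>0" for z
  proof -
    have eq: "critical_root \<alpha> M s = (\<lambda>z :: complex. - \<alpha> * z\<^sup>2 + \<i> * s * z + (csqrt (D z) - \<alpha> * M) / 2)"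
      by (rule ext) (simp only: critical_root_def D_def P_def of_real_mult of_real_minus of_real_power)
    show ?thesis
      unfolding eq F'_def using that
      by (auto intro!: derivative_eq_intros dD)
  qed
  have dF0: "(F' has_field_derivative complex_of_real (2 * (1 + \<alpha>\<^sup>2) * (s\<^sup>2 - M) / (\<alpha> * M))) (at 0)"
  proof -
    let ?c = "complex_of_real \<alpha> * complex_of_real M"
    have c: "csqrt (D 0) = ?c" "?c \<noteq> 0"
      using sq0 assms by (simp_all add: D0)
    have "(F' has_field_derivative - 2 * \<alpha> +
        ((- 8 * (2 * P 0 + M) - 8 * (P' 0)\<^sup>2) * (4 * ?c) - D' 0 * (4 * (D' 0 / (2 * ?c))))
           / ((4 * ?c) * (4 * ?c))) (at 0)"
      unfolding F'_def using c D0nn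
      by (auto intro!: derivative_eq_intros dD dD')
    moreover have "- 2 * \<alpha> +
        ((- 8 * (2 * P 0 + M) - 8 * (P' 0)\<^sup>2) * (4 * ?c) - D' 0 * (4 * (D' 0 / (2 * ?c))))
           / ((4 * ?c) * (4 * ?c)) = complex_of_real (2 * (1 + \<alpha>\<^sup>2) * (s\<^sup>2 - M) / (\<alpha> * M))"
      using c(2) by (simp add: P_def P'_def D'_def field_simps power2_eq_square)
    ultimately show ?thesis by simp
  qed
  show "\<exists>f'. (\<forall>\<^sub>F l in nhds 0. ((\<lambda>l. critical_root \<alpha> M s (complex_of_real l)) has_vector_derivative f' l) (at l)) \<and>
      (f' has_vector_derivative complex_of_real (2 * (1 + \<alpha>\<^sup>2) * (s\<^sup>2 - M) / (\<alpha> * M))) (at 0)"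
  proof (intro exI conjI)
    show "\<forall>\<^sub>F l in nhds 0. ((\<lambda>l. critical_root \<alpha> M s (complex_of_real l))
        has_vector_derivative F' (complex_of_real l)) (at l)"
      using ev by eventually_elim (auto intro!: has_vector_derivative_real_field dF)
    show "((\<lambda>l. F' (complex_of_real l)) has_vector_derivative
        complex_of_real (2 * (1 + \<alpha>\<^sup>2) * (s\<^sup>2 - M) / (\<alpha> * M))) (at 0)"
      using dF0 by (intro has_vector_derivative_real_field) simp
  qed
qed

lemma critical_curve_critical_root:
  assumes "\<alpha> > 0" "r \<noteq> 0" "k\<^sup>2 < \<mu>"
  shows "critical_curve \<alpha> \<mu> k r m3
    (\<lambda>l. critical_root \<alpha> (r\<^sup>2 * (\<mu> - k\<^sup>2)) (2 * k * m3) (complex_of_real l))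
    (- 2 * (1 + \<alpha>\<^sup>2) * stability_margin \<mu> k r m3 / (\<alpha> * (r\<^sup>2 * (\<mu> - k\<^sup>2))))"
proof -
  have M: "r\<^sup>2 * (\<mu> - k\<^sup>2) > 0" using assms by simp
  have num: "- 2 * (1 + \<alpha>\<^sup>2) * stability_margin \<mu> k r m3
      = 2 * (1 + \<alpha>\<^sup>2) * ((2 * k * m3)\<^sup>2 - r\<^sup>2 * (\<mu> - k\<^sup>2))"
    by (simp add: stability_margin_def algebra_simps)
  show ?thesis
    unfolding critical_curve_def num
    by (intro conjI critical_root_second_order(2)[OF assms(1) M] always_eventually allI
          critical_root_in_spectrum[OF assms(2)])
       (simp add: critical_root_second_order(1)[OF assms(1) M])
qed

text \<open>The real part \<open>g\<close> of the curve has \<open>g 0 = 0\<close> and positive second derivative at \<open>0\<close>.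
  If \<open>g' 0 < 0\<close>, it is positive just to the left of \<open>0\<close>; otherwise \<open>g'\<close> and hence \<open>g\<close> are positive
  just to the right.\<close>

lemma critical_curve_unstable_near_origin:
  assumes "critical_curve \<alpha> \<mu> k r m3 f d" "0 < d" "0 < \<epsilon>"
  shows "\<exists>z \<in> wavetrain_spectrum \<alpha> \<mu> k r m3. norm z < \<epsilon> \<and> 0 < Re z"
proof -
  from assms(1) obtain f' where f0: "f 0 = 0"
    and spec: "\<forall>\<^sub>F l in nhds 0. f l \<in> spectrum_at \<alpha> \<mu> k r m3 l"
    and d1: "\<forall>\<^sub>F l in nhds 0. (f has_vector_derivative f' l) (at l)"
    and d2: "(f' has_vector_derivative complex_of_real d) (at 0)"
    unfolding critical_curve_def by blast
  have "(f has_vector_derivative f' 0) (at 0)"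
    using eventually_nhds_x_imp_x[OF d1] .
  then have "isCont f 0"
    by (rule has_vector_derivative_continuous)
  then have "(f \<longlongrightarrow> 0) (nhds 0)"
    using isCont_tendsto_nhds f0 by metis
  then have "\<forall>\<^sub>F l in nhds 0. norm (f l) < \<epsilon>"
    using assms(3) by (simp add: tendsto_iff)
  with spec d1 have "\<forall>\<^sub>F l in nhds 0. f l \<in> spectrum_at \<alpha> \<mu> k r m3 l \<and> norm (f l) < \<epsilon> \<and>
      ((\<lambda>l. Re (f l)) has_real_derivative Re (f' l)) (at l)"
    by eventually_elim (auto simp: has_real_derivative_iff_has_vector_derivative
        intro: bounded_linear.has_vector_derivative[OF bounded_linear_Re])
  then obtain \<delta> where \<delta>: "\<delta> > 0"
    and near: "\<And>l. \<bar>l\<bar> < \<delta> \<Longrightarrow> f l \<in> spectrum_at \<alpha> \<mu> k r m3 l \<and> norm (f l) < \<epsilon> \<and>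
      ((\<lambda>l. Re (f l)) has_real_derivative Re (f' l)) (at l)"
    unfolding eventually_nhds_metric by (auto simp: dist_real_def)
  have "\<exists>l. \<bar>l\<bar> < \<delta> \<and> 0 < Re (f l)"
  proof (cases "Re (f' 0) < 0")
    case True
    then obtain e where "e > 0" "\<And>x. 0 < x \<Longrightarrow> x < e \<Longrightarrow> Re (f 0) < Re (f (0 - x))"
      using DERIV_neg_dec_left[of "\<lambda>l. Re (f l)" "Re (f' 0)" 0] near[of 0] \<delta> by auto
    then show ?thesis
      using \<delta> f0 by (intro exI[of _ "- (min e \<delta> / 2)"]) auto
  next
    case False
    have "((\<lambda>l. Re (f' l)) has_real_derivative d) (at 0)"
      using bounded_linear.has_vector_derivative[OF bounded_linear_Re d2]
      by (simp add: has_real_derivative_iff_has_vector_derivative)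
    then obtain e where e: "e > 0" "\<And>x. 0 < x \<Longrightarrow> x < e \<Longrightarrow> Re (f' 0) < Re (f' x)"
      using DERIV_pos_inc_right[of "\<lambda>l. Re (f' l)" d 0] assms(2) by auto
    define l where "l = min e \<delta> / 2"
    have l: "0 < l" "l < e" "l < \<delta>" using e \<delta> by (auto simp: l_def)
    then obtain x where x: "0 < x" "x < l" "Re (f l) - Re (f 0) = (l - 0) * Re (f' x)"
      using MVT2[of 0 l "\<lambda>l. Re (f l)" "\<lambda>l. Re (f' l)"] near by auto
    have "Re (f' x) > 0" using e(2)[of x] x l False by simp
    then have "Re (f l) > 0" using x f0 l by simp
    then show ?thesis using l by (intro exI[of _ l]) auto
  qed
  then show ?thesis
    using near unfolding wavetrain_spectrum_def by blast
qed

section \<open>Sideband instability along branches of wavetrains\<close>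

text \<open>The expression is the stability margin along the branch with \<open>H = h - \<beta> / \<alpha>\<close>, as a
  function of \<open>K = k\<^sup>2\<close>. Its first summand is \<open>\<mu> - K - H\<^sup>2 / (\<mu> - K)\<close>, so no term increases with \<open>K\<close>
  and \<open>- K\<close> decreases strictly.\<close>

lemma branch_margin_strict_antimono:
  fixes H \<mu> K K' :: real
  assumes "0 \<le> K" "K < K'" "K' < \<mu>"
  shows "(1 - (H / (\<mu> - K'))\<^sup>2) * (\<mu> - K') - 4 * K' * (H / (\<mu> - K'))\<^sup>2
       < (1 - (H / (\<mu> - K))\<^sup>2) * (\<mu> - K) - 4 * K * (H / (\<mu> - K))\<^sup>2"
proof -
  have "(1 - (H / y)\<^sup>2) * y = y - H\<^sup>2 / y" if "y \<noteq> 0" for y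
    using that by (simp add: field_simps power2_eq_square)
  then have eq: "(1 - (H / (\<mu> - x))\<^sup>2) * (\<mu> - x) = \<mu> - x - H\<^sup>2 / (\<mu> - x)" if "x < \<mu>" for x
    using that by simp
  have "\<bar>H / (\<mu> - K)\<bar> \<le> \<bar>H / (\<mu> - K')\<bar>"
    using assms by (auto simp: abs_divide intro!: divide_left_mono)
  then have "(H / (\<mu> - K))\<^sup>2 \<le> (H / (\<mu> - K'))\<^sup>2"
    by (simp only: abs_le_square_iff)
  then have "4 * K * (H / (\<mu> - K))\<^sup>2 \<le> 4 * K' * (H / (\<mu> - K'))\<^sup>2"
    using assms by (intro mult_mono) auto
  moreover have "H\<^sup>2 / (\<mu> - K) \<le> H\<^sup>2 / (\<mu> - K')"
    using assms by (intro divide_left_mono) auto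
  ultimately show ?thesis
    using assms eq[of K] eq[of K'] by simp
qed

text \<open>A vanishing margin together with \<open>h \<noteq> \<beta> / \<alpha>\<close> excludes \<open>m3 = 0\<close>, \<open>k = 0\<close> and
  \<open>k\<^sup>2 \<ge> \<mu>\<close>. The dispersion relation therefore continues the wavetrain to nearby \<open>k\<close>, and
  \<open>k\<^sup>2\<close> is strictly monotone in \<open>k\<close> there, increasing or decreasing according to the sign of \<open>k\<close>.\<close>

lemma sideband_instability_at_kstar:
  assumes "\<alpha> > 0" "h \<noteq> \<beta> / \<alpha>" "wavetrain \<alpha> \<beta> h \<mu> k0 \<omega> r0 m0" "k0\<^sup>2 = kstar_sq \<mu> r0"
  shows "sideband_instability \<alpha> \<beta> h \<mu> k0 r0 m0"
proof -
  define H where "H = h - \<beta> / \<alpha>"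
  have H: "H \<noteq> 0" using assms(2) by (simp add: H_def)
  have w0: "0 < r0" "r0\<^sup>2 + m0\<^sup>2 = 1" "(\<mu> - k0\<^sup>2) * m0 = H"
    using assms(3) unfolding wavetrain_iff[OF assms(1)] by (auto simp: H_def)
  have nz: "\<mu> - k0\<^sup>2 \<noteq> 0" "m0 \<noteq> 0" using w0(3) H by auto
  have marg0: "r0\<^sup>2 * (\<mu> - k0\<^sup>2) = (2 * k0 * m0)\<^sup>2"
    using kstar_sq_iff_margin(2)[OF w0(1,2)] assms(4) by (simp add: stability_margin_def)
  then have "r0\<^sup>2 * (\<mu> - k0\<^sup>2) \<ge> 0" by simp
  then have k0: "k0\<^sup>2 < \<mu>"
    using nz w0(1) by (simp add: zero_le_mult_iff)
  have "k0 \<noteq> 0" using marg0 nz w0(1) by auto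
  define m where "m k = H / (\<mu> - k\<^sup>2)" for k
  define r where "r k = sqrt (1 - (m k)\<^sup>2)" for k
  have m0: "m k0 = m0" using w0(3) nz by (simp add: m_def field_simps)
  have "1 - (m k0)\<^sup>2 = r0\<^sup>2" using w0(2) m0 by simp
  then have r0: "r k0 = r0" using w0(1) by (simp add: r_def)
  have cm: "isCont m k0" unfolding m_def using nz by (intro continuous_intros) auto
  have cr: "isCont r k0" unfolding r_def using cm by (intro continuous_intros)
  have nhds: "\<forall>\<^sub>F k in nhds k0. f k < f' k"
    if "isCont f k0" "isCont f' k0" "f k0 < f' k0" for f f' :: "real \<Rightarrow> real"
    using that order_tendstoD(1)[of "\<lambda>k. f' k - f k" "f' k0 - f k0" "nhds k0" 0]
    by (auto simp: isCont_def tendsto_at_iff_tendsto_nhds intro!: tendsto_diff)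
  have m0less: "(m k0)\<^sup>2 < 1" using w0(2) zero_less_power[OF w0(1), of 2] unfolding m0 by linarith
  have near: "\<forall>\<^sub>F k in nhds k0. k\<^sup>2 < \<mu> \<and> (m k)\<^sup>2 < 1"
    using k0 m0less cm by (intro eventually_conj nhds) (auto intro!: continuous_intros)
  define d where "d k = - 2 * (1 + \<alpha>\<^sup>2) * stability_margin \<mu> k (r k) (m k)
      / (\<alpha> * ((r k)\<^sup>2 * (\<mu> - k\<^sup>2)))" for k
  define f where "f k = (\<lambda>l. critical_root \<alpha> ((r k)\<^sup>2 * (\<mu> - k\<^sup>2)) (2 * k * m k) (complex_of_real l))" for k
  have branch: "\<forall>\<^sub>F k in nhds k0. wavetrain \<alpha> \<beta> h \<mu> k (- \<beta> / \<alpha>) (r k) (m k) \<and>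
      critical_curve \<alpha> \<mu> k (r k) (m k) (f k) (d k)"
    using near
  proof eventually_elim
    case (elim k)
    then have "r k > 0" "(r k)\<^sup>2 + (m k)\<^sup>2 = 1" by (simp_all add: r_def)
    moreover have "(\<mu> - k\<^sup>2) * m k = h - \<beta> / \<alpha>"
      using elim by (simp add: m_def H_def)
    ultimately show ?case
      unfolding wavetrain_iff[OF assms(1)] f_def d_def
      using critical_curve_critical_root[OF assms(1)] elim by simp
  qed
  have margin: "stability_margin \<mu> k (r k) (m k)
      = (1 - (H / (\<mu> - k\<^sup>2))\<^sup>2) * (\<mu> - k\<^sup>2) - 4 * k\<^sup>2 * (H / (\<mu> - k\<^sup>2))\<^sup>2" if "(m k)\<^sup>2 < 1" for k
  proof -
    have r2: "(r k)\<^sup>2 = 1 - (m k)\<^sup>2" using that by (simp add: r_def)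
    show ?thesis
      unfolding stability_margin_def r2 by (simp add: m_def power_mult_distrib power_divide)
  qed
  have margin0: "stability_margin \<mu> k0 (r k0) (m k0) = 0"
    using marg0 by (simp add: stability_margin_def m0 r0)
  have sgn: "(k\<^sup>2 < k0\<^sup>2 \<longrightarrow> d k < 0) \<and> (k0\<^sup>2 < k\<^sup>2 \<longrightarrow> 0 < d k)" if k: "k\<^sup>2 < \<mu> \<and> (m k)\<^sup>2 < 1" for k
  proof -
    have pos: "\<alpha> * ((r k)\<^sup>2 * (\<mu> - k\<^sup>2)) > 0" "1 + \<alpha>\<^sup>2 > 0"
      using k assms(1) by (simp_all add: r_def add_pos_nonneg)
    have "stability_margin \<mu> k (r k) (m k) > 0" if "k\<^sup>2 < k0\<^sup>2"
      using branch_margin_strict_antimono[OF zero_le_power2 that k0, of H]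
        margin[of k] margin[OF m0less] margin0 k by simp
    moreover have "stability_margin \<mu> k (r k) (m k) < 0" if "k0\<^sup>2 < k\<^sup>2"
      using branch_margin_strict_antimono[OF zero_le_power2 that, of \<mu> H]
        margin[of k] margin[OF m0less] margin0 k by simp
    ultimately show ?thesis
      using pos by (auto simp: d_def zero_less_divide_iff divide_less_0_iff zero_less_mult_iff mult_less_0_iff)
  qed
  then have sgn_less: "\<And>k. k\<^sup>2 < \<mu> \<and> (m k)\<^sup>2 < 1 \<Longrightarrow> k\<^sup>2 < k0\<^sup>2 \<Longrightarrow> d k < 0"
    and sgn_greater: "\<And>k. k\<^sup>2 < \<mu> \<and> (m k)\<^sup>2 < 1 \<Longrightarrow> k0\<^sup>2 < k\<^sup>2 \<Longrightarrow> 0 < d k"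
    by blast+
  have near': "\<forall>\<^sub>F k in at k0 within S. k\<^sup>2 < \<mu> \<and> (m k)\<^sup>2 < 1" for S
    using near by (rule filter_leD[OF at_within_le_nhds])
  have "changes_sign_at d k0"
  proof (cases "k0 > 0")
    case True
    have "\<forall>\<^sub>F k in at_left k0. d k < 0"
      using near' eventually_at_left_real[OF True]
      by eventually_elim (auto intro!: sgn_less power_strict_mono)
    moreover have "\<forall>\<^sub>F k in at_right k0. 0 < d k"
      using near' eventually_at_right_less
      by eventually_elim (use True in \<open>auto intro!: sgn_greater power_strict_mono\<close>)
    ultimately show ?thesis by (simp add: changes_sign_at_def)
  next
    case False
    then have neg: "k0 < 0" using \<open>k0 \<noteq> 0\<close> by simp
    have sq: "a\<^sup>2 < b\<^sup>2" if "b < a" "a < 0" for a b :: real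
      using power_strict_mono[of "-a" "-b" 2] that by simp
    have "\<forall>\<^sub>F k in at_left k0. 0 < d k"
      using near' eventually_at_left_real[of "k0 - 1" k0, simplified]
      by eventually_elim (use neg in \<open>auto intro!: sgn_greater sq\<close>)
    moreover have "\<forall>\<^sub>F k in at_right k0. d k < 0"
      using near' eventually_at_right_real[OF neg]
      by eventually_elim (auto intro!: sgn_less sq)
    ultimately show ?thesis by (simp add: changes_sign_at_def)
  qed
  moreover have "\<forall>\<^sub>F k in nhds k0. 0 < d k \<longrightarrow>
           (\<forall>\<epsilon>>0. \<exists>z \<in> wavetrain_spectrum \<alpha> \<mu> k (r k) (m k). norm z < \<epsilon> \<and> 0 < Re z)"
    using branch by eventually_elim (use critical_curve_unstable_near_origin in blast)
  ultimately show ?thesis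
    unfolding sideband_instability_def
    using r0 m0 cr cm branch
    by (intro exI[of _ "\<lambda>_. - \<beta> / \<alpha>"] exI[of _ r] exI[of _ m] exI[of _ f] exI[of _ d]) simp
qed

text \<open>Along the branch, which exists for \<open>k\<^sup>2 < \<mu> - \<bar>h - \<beta> / \<alpha>\<bar>\<close>, the margin is positive at
  \<open>k = 0\<close> and becomes negative at the end, where \<open>\<bar>m3\<bar> = 1\<close>.\<close>

lemma wavetrain_at_kstar_exists:
  assumes "\<alpha> > 0" "h \<noteq> \<beta> / \<alpha>" "\<bar>h - \<beta> / \<alpha>\<bar> < \<mu>"
  shows "\<exists>ks>0. \<forall>k\<in>{ks, - ks}. \<exists>\<omega> r m3. wavetrain \<alpha> \<beta> h \<mu> k \<omega> r m3 \<and> k\<^sup>2 = kstar_sq \<mu> r"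
proof -
  define H where "H = h - \<beta> / \<alpha>"
  have H: "H \<noteq> 0" "\<bar>H\<bar> < \<mu>" using assms(2,3) by (simp_all add: H_def)
  define g where "g K = 4 * K * (H / (\<mu> - K))\<^sup>2 - (1 - (H / (\<mu> - K))\<^sup>2) * (\<mu> - K)" for K
  let ?K = "\<mu> - \<bar>H\<bar>"
  have "g 0 < 0"
  proof -
    have "\<bar>H / \<mu>\<bar> < 1" using H by (simp add: abs_divide)
    then have "(H / \<mu>)\<^sup>2 < 1" by (simp only: abs_square_less_1)
    then show ?thesis using H by (simp add: g_def)
  qed
  moreover have gK: "g ?K = 4 * ?K"
    using H by (simp add: g_def power_divide)
  moreover have "continuous_on {0..?K} g"
    unfolding g_def using H by (intro continuous_intros) auto
  ultimately obtain K where K: "0 \<le> K" "K \<le> ?K" "g K = 0"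
    using IVT'[of g 0 0 ?K] H by auto
  have "K \<noteq> 0" "K \<noteq> ?K" using K(3) \<open>g 0 < 0\<close> gK H by auto
  then have K': "0 < K" "K < ?K" using K by auto
  define m where "m = H / (\<mu> - K)"
  have "\<bar>m\<bar> < 1" using K' H by (simp add: m_def abs_divide)
  then have m1: "m\<^sup>2 < 1" by (simp only: abs_square_less_1)
  define r where "r = sqrt (1 - m\<^sup>2)"
  have r: "0 < r" "r\<^sup>2 + m\<^sup>2 = 1" using m1 by (simp_all add: r_def)
  have at_kstar: "wavetrain \<alpha> \<beta> h \<mu> k (- \<beta> / \<alpha>) r m \<and> k\<^sup>2 = kstar_sq \<mu> r" if k: "k\<^sup>2 = K" for k
  proof
    have "\<mu> - K \<noteq> 0" using K' H by simp
    then show "wavetrain \<alpha> \<beta> h \<mu> k (- \<beta> / \<alpha>) r m"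
      unfolding wavetrain_iff[OF assms(1)] using r k by (simp add: m_def H_def)
    have "r\<^sup>2 = 1 - m\<^sup>2" using r(2) by simp
    then have "stability_margin \<mu> k r m = - g K"
      by (simp add: stability_margin_def g_def m_def power_mult_distrib power_divide k)
    then show "k\<^sup>2 = kstar_sq \<mu> r"
      using kstar_sq_iff_margin(2)[OF r] K(3) by simp
  qed
  have "\<forall>k\<in>{sqrt K, - sqrt K}. wavetrain \<alpha> \<beta> h \<mu> k (- \<beta> / \<alpha>) r m \<and> k\<^sup>2 = kstar_sq \<mu> r"
  proof
    fix k
    assume "k \<in> {sqrt K, - sqrt K}"
    then have "k\<^sup>2 = K" using K'(1) by auto
    then show "wavetrain \<alpha> \<beta> h \<mu> k (- \<beta> / \<alpha>) r m \<and> k\<^sup>2 = kstar_sq \<mu> r"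
      by (rule at_kstar)
  qed
  moreover have "sqrt K > 0" using K'(1) by simp
  ultimately show ?thesis by blast
qed

section \<open>Transitions and supercritical anisotropy\<close>

text \<open>The sign of the margin decides stability and the margin is continuous in \<open>(k, r, m3)\<close>, so it
  cannot have a strict sign at a limit of both stable and unstable wavetrains.\<close>

lemma margin_zero_at_transition:
  assumes "\<alpha> > 0" "0 < r" "stability_transition \<alpha> \<beta> h \<mu> k r m3"
  shows "stability_margin \<mu> k r m3 = 0"
proof -
  define g :: "real \<times> real \<times> real \<Rightarrow> real"
    where "g p = stability_margin \<mu> (fst p) (fst (snd p)) (snd (snd p))" for p
  have cont: "isCont g (k, r, m3)"
    unfolding g_def stability_margin_def by (intro continuous_intros)
  have unst: "spectrally_unstable \<alpha> \<mu> k' r' m3' \<longleftrightarrow> g (k', r', m3') < 0"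
    if "wavetrain \<alpha> \<beta> h \<mu> k' \<omega>' r' m3'" for k' \<omega>' r' m3'
    using spectrally_unstable_iff_margin[OF assms(1), of r'] that by (auto simp: wavetrain_def g_def)
  have "\<not> g (k, r, m3) < 0"
  proof
    assume neg: "g (k, r, m3) < 0"
    obtain \<delta> where \<delta>: "\<delta> > 0" "\<And>p. dist p (k, r, m3) < \<delta> \<Longrightarrow> dist (g p) (g (k, r, m3)) < - g (k, r, m3)"
      using cont neg unfolding continuous_at_eps_delta by (metis neg_0_less_iff_less)
    obtain k' \<omega>' r' m3' where w: "wavetrain \<alpha> \<beta> h \<mu> k' \<omega>' r' m3'"
      "dist (k', r', m3') (k, r, m3) < \<delta>" "spectrally_stable \<alpha> \<mu> k' r' m3'"
      using assms(3) \<delta>(1) unfolding stability_transition_def by blast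
    then have "g (k', r', m3') < 0"
      using \<delta>(2)[of "(k', r', m3')"] by (simp add: dist_real_def)
    with w unst[OF w(1)] show False
      by (auto simp: spectrally_stable_def spectrally_unstable_def)
  qed
  moreover have "\<not> g (k, r, m3) > 0"
  proof
    assume pos: "g (k, r, m3) > 0"
    obtain \<delta> where \<delta>: "\<delta> > 0" "\<And>p. dist p (k, r, m3) < \<delta> \<Longrightarrow> dist (g p) (g (k, r, m3)) < g (k, r, m3)"
      using cont pos unfolding continuous_at_eps_delta by metis
    obtain k' \<omega>' r' m3' where w: "wavetrain \<alpha> \<beta> h \<mu> k' \<omega>' r' m3'"
      "dist (k', r', m3') (k, r, m3) < \<delta>" "spectrally_unstable \<alpha> \<mu> k' r' m3'"
      using assms(3) \<delta>(1) unfolding stability_transition_def by blast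
    then have "g (k', r', m3') > 0"
      using \<delta>(2)[of "(k', r', m3')"] by (auto simp: dist_real_def)
    with w unst[OF w(1)] show False by simp
  qed
  ultimately show ?thesis by (simp add: g_def)
qed

text \<open>At \<open>k\<^sup>2 = \<mu>\<close> the dispersion relation gives \<open>h = \<beta> / \<alpha>\<close>, and \<open>\<mu> > 0\<close> because the
  trivial case \<open>k = \<mu> = 0\<close> is excluded. For \<open>k\<^sup>2 < \<mu>\<close> the strict inequality comes from
  \<open>r \<noteq> 0\<close>, that is \<open>\<bar>m3\<bar> < 1\<close>.\<close>

lemma stable_wavetrain_supercritical:
  assumes "\<alpha> > 0" "wavetrain \<alpha> \<beta> h \<mu> k \<omega> r m3" "k \<noteq> 0 \<or> \<mu> \<noteq> 0" "spectrally_stable \<alpha> \<mu> k r m3"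
  shows "\<bar>h - \<beta> / \<alpha>\<bar> < \<mu>"
proof -
  have w: "0 < r" "r\<^sup>2 + m3\<^sup>2 = 1" "h - \<beta> / \<alpha> = (\<mu> - k\<^sup>2) * m3"
    using assms(2) unfolding wavetrain_iff[OF assms(1)] by auto
  have marg: "r\<^sup>2 * (\<mu> - k\<^sup>2) \<ge> (2 * k * m3)\<^sup>2"
    using assms(4) spectrally_unstable_iff_margin[OF assms(1), of r \<mu> k m3] w(1)
    by (auto simp: spectrally_stable_def spectrally_unstable_def stability_margin_def)
  then have "r\<^sup>2 * (\<mu> - k\<^sup>2) \<ge> 0"
    by (meson order_trans zero_le_power2)
  then have "k\<^sup>2 \<le> \<mu>" using w(1) by (simp add: zero_le_mult_iff)
  show ?thesis
  proof (cases "k\<^sup>2 = \<mu>")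
    case True
    then have "\<mu> > 0" using assms(3) by auto
    then show ?thesis using True w(3) by simp
  next
    case False
    then have "\<mu> - k\<^sup>2 > 0" using \<open>k\<^sup>2 \<le> \<mu>\<close> by simp
    moreover have "m3\<^sup>2 < 1"
      using w(2) zero_less_power[OF w(1), of 2] by linarith
    then have "\<bar>m3\<bar> < 1"
      by (simp only: abs_square_less_1)
    ultimately have "\<bar>(\<mu> - k\<^sup>2) * m3\<bar> < \<mu> - k\<^sup>2"
      by (simp add: abs_mult)
    also have "\<dots> \<le> \<mu>" by simp
    finally show ?thesis using w(3) by simp
  qed
qed

text \<open>The case \<open>h = \<beta> / \<alpha>\<close> does not occur: it would mean \<open>m3 = 0\<close>, where the margin is strictly
  positive.\<close>

lemma no_secondary_instability:
  assumes "\<alpha> > 0" "wavetrain \<alpha> \<beta> h \<mu> k \<omega> r m3" "k\<^sup>2 < \<mu>" "stability_transition \<alpha> \<beta> h \<mu> k r m3"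
  shows "k\<^sup>2 = kstar_sq \<mu> r" and "sideband_instability \<alpha> \<beta> h \<mu> k r m3"
proof -
  have w: "0 < r" "r\<^sup>2 + m3\<^sup>2 = 1" "(\<mu> - k\<^sup>2) * m3 = h - \<beta> / \<alpha>"
    using assms(2) unfolding wavetrain_iff[OF assms(1)] by auto
  have marg: "stability_margin \<mu> k r m3 = 0"
    using margin_zero_at_transition[OF assms(1) w(1) assms(4)] .
  then show *: "k\<^sup>2 = kstar_sq \<mu> r"
    using kstar_sq_iff_margin(2)[OF w(1,2)] by simp
  have "m3 \<noteq> 0" using marg w(1) assms(3) by (auto simp: stability_margin_def)
  then have "h \<noteq> \<beta> / \<alpha>" using w(3) assms(3) by auto
  then show "sideband_instability \<alpha> \<beta> h \<mu> k r m3"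
    using sideband_instability_at_kstar assms(1,2) * by blast
qed

lemma spectrally_unstable_iff_critical_curve:
  assumes "\<alpha> > 0" "0 < r" "k\<^sup>2 < \<mu>"
  shows "\<exists>f d. critical_curve \<alpha> \<mu> k r m3 f d \<and> (spectrally_unstable \<alpha> \<mu> k r m3 \<longleftrightarrow> 0 < d)"
proof -
  have pos: "\<alpha> * (r\<^sup>2 * (\<mu> - k\<^sup>2)) > 0" "1 + \<alpha>\<^sup>2 > 0"
    using assms by (simp_all add: add_pos_nonneg)
  have "r \<noteq> 0" using assms(2) by simp
  note unst = spectrally_unstable_iff_margin[OF assms(1) this, of \<mu> k m3]
  have "spectrally_unstable \<alpha> \<mu> k r m3 \<longleftrightarrow>
      0 < - 2 * (1 + \<alpha>\<^sup>2) * stability_margin \<mu> k r m3 / (\<alpha> * (r\<^sup>2 * (\<mu> - k\<^sup>2)))"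
    unfolding unst zero_less_divide_iff using pos by (auto simp: zero_less_mult_iff mult_less_0_iff)
  then show ?thesis
    using critical_curve_critical_root[OF assms(1) \<open>r \<noteq> 0\<close> assms(3)] by blast
qed

theorem theorem4:
  fixes \<alpha> \<beta> h \<mu> :: real
  assumes "\<alpha> > 0"
  shows
    "(\<forall>k \<omega> r m3. wavetrain \<alpha> \<beta> h \<mu> k \<omega> r m3 \<longrightarrow> k\<^sup>2 > kstar_sq \<mu> r \<longrightarrow>
        spectrally_unstable \<alpha> \<mu> k r m3) \<and>
     (\<mu> > 0 \<longrightarrow> (\<forall>k \<omega> r m3. wavetrain \<alpha> \<beta> h \<mu> k \<omega> r m3 \<longrightarrow>
        (\<bar>k\<bar> < sqrt (kstar_sq \<mu> r) \<longrightarrow> spectrally_stable \<alpha> \<mu> k r m3) \<and>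
        (\<bar>k\<bar> > sqrt (kstar_sq \<mu> r) \<longrightarrow> spectrally_unstable \<alpha> \<mu> k r m3))) \<and>
     (h \<noteq> \<beta> / \<alpha> \<longrightarrow>
        (\<forall>k \<omega> r m3. wavetrain \<alpha> \<beta> h \<mu> k \<omega> r m3 \<longrightarrow> k\<^sup>2 = kstar_sq \<mu> r \<longrightarrow>
           sideband_instability \<alpha> \<beta> h \<mu> k r m3) \<and>
        (\<bar>h - \<beta> / \<alpha>\<bar> < \<mu> \<longrightarrow> (\<exists>ks>0. \<forall>k\<in>{ks, - ks}. \<exists>\<omega> r m3.
           wavetrain \<alpha> \<beta> h \<mu> k \<omega> r m3 \<and> k\<^sup>2 = kstar_sq \<mu> r))) \<and>
     (\<forall>k \<omega> r m3. wavetrain \<alpha> \<beta> h \<mu> k \<omega> r m3 \<longrightarrow> k\<^sup>2 < \<mu> \<longrightarrow>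
        (stability_transition \<alpha> \<beta> h \<mu> k r m3 \<longrightarrow>
           k\<^sup>2 = kstar_sq \<mu> r \<and> sideband_instability \<alpha> \<beta> h \<mu> k r m3) \<and>
        (\<exists>f d. critical_curve \<alpha> \<mu> k r m3 f d \<and>
           (spectrally_unstable \<alpha> \<mu> k r m3 \<longleftrightarrow> 0 < d))) \<and>
     (\<forall>k \<omega> r m3. wavetrain \<alpha> \<beta> h \<mu> k \<omega> r m3 \<longrightarrow> k \<noteq> 0 \<or> \<mu> \<noteq> 0 \<longrightarrow>
        spectrally_stable \<alpha> \<mu> k r m3 \<longrightarrow> \<bar>h - \<beta> / \<alpha>\<bar> < \<mu>)"
proof (intro conjI allI impI)
  have kstar: "kstar_sq \<mu> r < k\<^sup>2 \<longleftrightarrow> spectrally_unstable \<alpha> \<mu> k r m3"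
    if "wavetrain \<alpha> \<beta> h \<mu> k \<omega> r m3" for k \<omega> r m3
    using that kstar_sq_iff_margin(1)[of r m3 \<mu> k] spectrally_unstable_iff_margin[OF assms, of r \<mu> k m3]
    unfolding wavetrain_iff[OF assms] by auto
  fix k \<omega> r m3
  assume w: "wavetrain \<alpha> \<beta> h \<mu> k \<omega> r m3"
  show "spectrally_unstable \<alpha> \<mu> k r m3" if "k\<^sup>2 > kstar_sq \<mu> r"
    using kstar[OF w] that by simp
  show "spectrally_stable \<alpha> \<mu> k r m3" if "\<bar>k\<bar> < sqrt (kstar_sq \<mu> r)"
  proof -
    have "k\<^sup>2 < kstar_sq \<mu> r"
      using that by (metis real_sqrt_abs real_sqrt_less_iff)
    then show ?thesis
      using kstar[OF w] by (auto simp: spectrally_stable_def spectrally_unstable_def)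
  qed
  show "spectrally_unstable \<alpha> \<mu> k r m3" if "\<bar>k\<bar> > sqrt (kstar_sq \<mu> r)"
    using kstar[OF w] that by (metis real_sqrt_abs real_sqrt_less_iff)
  show "k\<^sup>2 = kstar_sq \<mu> r" "sideband_instability \<alpha> \<beta> h \<mu> k r m3"
    if "k\<^sup>2 < \<mu>" "stability_transition \<alpha> \<beta> h \<mu> k r m3"
    using no_secondary_instability[OF assms w that] by simp_all
  show "\<exists>f d. critical_curve \<alpha> \<mu> k r m3 f d \<and> (spectrally_unstable \<alpha> \<mu> k r m3 \<longleftrightarrow> 0 < d)"
    if "k\<^sup>2 < \<mu>"
    using spectrally_unstable_iff_critical_curve[OF assms _ that] w by (simp add: wavetrain_def)
  show "\<bar>h - \<beta> / \<alpha>\<bar> < \<mu>" if "k \<noteq> 0 \<or> \<mu> \<noteq> 0" "spectrally_stable \<alpha> \<mu> k r m3"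
    using stable_wavetrain_supercritical[OF assms w that] .
  show "sideband_instability \<alpha> \<beta> h \<mu> k r m3" if "h \<noteq> \<beta> / \<alpha>" "k\<^sup>2 = kstar_sq \<mu> r"
    using sideband_instability_at_kstar[OF assms that(1) w that(2)] .
next
  show "\<exists>ks>0. \<forall>k\<in>{ks, - ks}. \<exists>\<omega> r m3. wavetrain \<alpha> \<beta> h \<mu> k \<omega> r m3 \<and> k\<^sup>2 = kstar_sq \<mu> r"
    if "h \<noteq> \<beta> / \<alpha>" "\<bar>h - \<beta> / \<alpha>\<bar> < \<mu>"
    using wavetrain_at_kstar_exists[OF assms that] .
qed

end
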